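(* Let $G$ be a finite non-abelian CA group with center of size $z$ such that the centralizers of all non-central elements have the same size $c$. Then for every $\varepsilon\in(0,1)$ the mixing time of the commuting chain on $G$ satisfies \[t_{mix}(\varepsilon)\le\left\lceil\frac1\alpha\log\left(\frac1\varepsilon\right)\right\rceil,\qquad \text{where } \alpha=\min\left\{\frac zc,\frac{c}{|G|}\right\}.\]
   Context: For a finite group $G$ with center $Z$ and $x\in G$, let $C_x=\{h\in G: hx=xh\}$ be the centralizer and $x^G$ the conjugacy class of $x$. $G$ is a CA group if commutativity is a transitive relation on $G\setminus Z$ (equivalently, the centralizer of every non-central element is abelian). The commuting chain on $G$ is the Markov chain with state space $G$ and transition matrix $P(x,y)=\frac{1}{|C_x|}\mathbf 1_{\{xy=yx\}}$; it is irreducible, aperiodic and reversible with stationary distribution $\pi(x)=\frac{1}{k|x^G|}$, where $k$ is the number of conjugacy classes of $G$. Total variation distance: $\Vert\mu-\nu\Vert_{TV}=\sup_{A}|\mu(A)-\nu(A)|$. Put $d(t)=\max_x\Vert P^t(x,\cdot)-\pi\Vert_{TV}$ and $t_{mix}(\varepsilon)=\min\{t: d(t)\le\varepsilon\}$. $\log$ is the natural logarithm. *)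

theory Defs
  imports Complex_Main "HOL-Library.Extended_Nat" "HOL-Algebra.Group_Action"
begin

section \<open>Markov chains on a finite state space\<close>

text \<open>
  Distributions and transition matrices on a finite state space \<open>S\<close> are real-valued functions;
  only their values on \<open>S\<close> matter.
\<close>

primrec matrix_power :: "'a set \<Rightarrow> ('a \<Rightarrow> 'a \<Rightarrow> real) \<Rightarrow> nat \<Rightarrow> 'a \<Rightarrow> 'a \<Rightarrow> real" where
  "matrix_power S P 0 x y = (if x = y then 1 else 0)"
| "matrix_power S P (Suc t) x y = (\<Sum>w\<in>S. matrix_power S P t x w * P w y)"

definition tv_dist :: "'a set \<Rightarrow> ('a \<Rightarrow> real) \<Rightarrow> ('a \<Rightarrow> real) \<Rightarrow> real" where
  "tv_dist S \<mu> \<nu> = (SUP A\<in>Pow S. \<bar>sum \<mu> A - sum \<nu> A\<bar>)"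

definition worst_dist :: "'a set \<Rightarrow> ('a \<Rightarrow> 'a \<Rightarrow> real) \<Rightarrow> ('a \<Rightarrow> real) \<Rightarrow> nat \<Rightarrow> real" where
  "worst_dist S P \<pi> t = (MAX x\<in>S. tv_dist S (matrix_power S P t x) \<pi>)"

text \<open>
  The minimum is taken in \<^typ>\<open>enat\<close>, so that it is \<open>\<infinity>\<close> if no time \<open>t\<close> is good enough; a finite
  upper bound on the mixing time thus entails that the minimum exists.
\<close>

definition mixing_time ::
    "'a set \<Rightarrow> ('a \<Rightarrow> 'a \<Rightarrow> real) \<Rightarrow> ('a \<Rightarrow> real) \<Rightarrow> real \<Rightarrow> enat" where
  "mixing_time S P \<pi> \<epsilon> = (INF t\<in>{t. worst_dist S P \<pi> t \<le> \<epsilon>}. enat t)"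

section \<open>Centralizers, conjugacy classes and CA groups\<close>

definition center :: "('a, 'b) monoid_scheme \<Rightarrow> 'a set" where
  "center G = {x \<in> carrier G. \<forall>h\<in>carrier G. h \<otimes>\<^bsub>G\<^esub> x = x \<otimes>\<^bsub>G\<^esub> h}"

definition centralizer :: "('a, 'b) monoid_scheme \<Rightarrow> 'a \<Rightarrow> 'a set" where
  "centralizer G x = {h \<in> carrier G. h \<otimes>\<^bsub>G\<^esub> x = x \<otimes>\<^bsub>G\<^esub> h}"

definition conj_action :: "('a, 'b) monoid_scheme \<Rightarrow> 'a \<Rightarrow> 'a \<Rightarrow> 'a" where
  "conj_action G = (\<lambda>g. \<lambda>h\<in>carrier G. g \<otimes>\<^bsub>G\<^esub> h \<otimes>\<^bsub>G\<^esub> inv\<^bsub>G\<^esub> g)"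

definition conj_class :: "('a, 'b) monoid_scheme \<Rightarrow> 'a \<Rightarrow> 'a set" where
  "conj_class G x = orbit G (conj_action G) x"

definition conj_classes :: "('a, 'b) monoid_scheme \<Rightarrow> 'a set set" where
  "conj_classes G = orbits G (carrier G) (conj_action G)"

locale CA_group = group +
  assumes commute_trans:
    "\<lbrakk> x \<in> carrier G - center G; y \<in> carrier G - center G; w \<in> carrier G - center G;
       x \<otimes> y = y \<otimes> x; y \<otimes> w = w \<otimes> y \<rbrakk> \<Longrightarrow> x \<otimes> w = w \<otimes> x"

section \<open>The commuting chain\<close>

definition commuting_chain :: "('a, 'b) monoid_scheme \<Rightarrow> 'a \<Rightarrow> 'a \<Rightarrow> real" where
  "commuting_chain G x y =
     (if x \<otimes>\<^bsub>G\<^esub> y = y \<otimes>\<^bsub>G\<^esub> x then 1 / real (card (centralizer G x)) else 0)"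

definition commuting_stationary :: "('a, 'b) monoid_scheme \<Rightarrow> 'a \<Rightarrow> real" where
  "commuting_stationary G x = 1 / (real (card (conj_classes G)) * real (card (conj_class G x)))"

definition commuting_mixing_time :: "('a, 'b) monoid_scheme \<Rightarrow> real \<Rightarrow> enat" where
  "commuting_mixing_time G =
     mixing_time (carrier G) (commuting_chain G) (commuting_stationary G)"

end

theory Submission
  imports Defs
begin

text \<open>
  Any two rows of the transition matrix have overlap
  \<open>\<Sum>w. min (P x w) (P y w) \<ge> \<alpha>\<close>: two non-central rows share the mass \<open>1 / c\<close> on each of the \<open>z\<close>
  central elements, and a central row is uniform on \<open>G\<close>, so that it shares mass \<open>1 / |G|\<close> with a
  non-central row on each of \<open>c\<close> elements. Hence (Dobrushin) each step contracts the oscillation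
  \<open>max f - min f\<close> of an observable \<open>f\<close> by the factor \<open>1 - \<alpha>\<close>, which gives
  \<open>d(t) \<le> (1 - \<alpha>) ^ t \<le> exp (- \<alpha> t)\<close>.
\<close>

section \<open>Contraction of finite Markov chains\<close>

text \<open>Removing the common part \<open>m\<close> from both rows leaves nonnegative remainders
  of equal mass \<open>1 - sum m S\<close>. The averages of \<open>f\<close> against them differ by
  at most this mass times \<open>b\<close>.\<close>

lemma oscillation_contraction:
  fixes P :: "'a \<Rightarrow> 'a \<Rightarrow> real"
  assumes fin: "finite S" and x: "x \<in> S" and y: "y \<in> S"
    and row: "\<And>x. x \<in> S \<Longrightarrow> (\<Sum>w\<in>S. P x w) = 1"
    and overlap: "\<alpha> \<le> (\<Sum>w\<in>S. min (P x w) (P y w))"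
    and osc: "\<And>u v. u \<in> S \<Longrightarrow> v \<in> S \<Longrightarrow> f u - f v \<le> b"
  shows "(\<Sum>w\<in>S. P x w * f w) - (\<Sum>w\<in>S. P y w * f w) \<le> (1 - \<alpha>) * b"
proof -
  define m where "m w = min (P x w) (P y w)" for w
  define l where "l = Min (f ` S)"
  have "l \<in> f ` S"
    unfolding l_def using fin x by (intro Min_in) auto
  then have upper: "f w \<le> l + b" if "w \<in> S" for w
    using osc[OF that] by force
  have lower: "l \<le> f w" if "w \<in> S" for w
    unfolding l_def using fin that by simp
  \<comment> \<open>This sign lets \<open>\<alpha>\<close> replace the overlap
    \<open>sum m S\<close> in the last estimate.\<close>
  have "b \<ge> 0"
    using osc[OF x x] by simp
  have "(\<Sum>w\<in>S. P x w * f w) - (\<Sum>w\<in>S. P y w * f w)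
      = (\<Sum>w\<in>S. (P x w - m w) * f w) - (\<Sum>w\<in>S. (P y w - m w) * f w)"
    by (simp add: algebra_simps sum_subtractf)
  also have "\<dots> \<le> (\<Sum>w\<in>S. (P x w - m w) * (l + b)) - (\<Sum>w\<in>S. (P y w - m w) * l)"
    using upper lower by (intro diff_mono sum_mono mult_left_mono) (auto simp: m_def)
  also have "\<dots> = (1 - sum m S) * b"
    unfolding sum_distrib_right[symmetric] sum_subtractf row[OF x] row[OF y]
    by (simp add: algebra_simps)
  also have "\<dots> \<le> (1 - \<alpha>) * b"
    using overlap \<open>b \<ge> 0\<close> by (intro mult_right_mono) (simp_all add: m_def)
  finally show ?thesis .
qed

text \<open>The recursion of \<open>matrix_power\<close> appends the last step, so that step can be
  absorbed into the observable: \<open>f\<close> is replaced by its one-step average. This is why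
  the inductions below run over arbitrary \<open>f\<close>.\<close>

lemma matrix_power_Suc_apply:
  "finite S \<Longrightarrow> (\<Sum>w\<in>S. matrix_power S P (Suc t) x w * f w)
    = (\<Sum>v\<in>S. matrix_power S P t x v * (\<Sum>w\<in>S. P v w * f w))"
  by (simp add: sum_distrib_right sum_distrib_left mult.assoc) (rule sum.swap)

lemma matrix_power_0_apply:
  "finite S \<Longrightarrow> x \<in> S \<Longrightarrow> (\<Sum>w\<in>S. matrix_power S P 0 x w * f w) = f x"
  by (simp add: if_distrib[of "\<lambda>c. c * _"] cong: if_cong)

lemma matrix_power_oscillation:
  assumes fin: "finite S" and "x \<in> S" and "y \<in> S"
    and row: "\<And>x. x \<in> S \<Longrightarrow> (\<Sum>w\<in>S. P x w) = 1"
    and overlap: "\<And>x y. x \<in> S \<Longrightarrow> y \<in> S \<Longrightarrow> \<alpha> \<le> (\<Sum>w\<in>S. min (P x w) (P y w))"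
    and osc: "\<And>u v. u \<in> S \<Longrightarrow> v \<in> S \<Longrightarrow> f u - f v \<le> b"
  shows "(\<Sum>w\<in>S. matrix_power S P t x w * f w) - (\<Sum>w\<in>S. matrix_power S P t y w * f w)
    \<le> (1 - \<alpha>) ^ t * b"
  using osc
proof (induction t arbitrary: f b)
  case 0
  then show ?case
    using assms(1-3) by (simp only: matrix_power_0_apply) simp
next
  case (Suc t)
  show ?case
    \<comment> \<open>The one-step average of \<open>f\<close> has oscillation at most
      \<open>(1 - \<alpha>) * b\<close>, and the induction hypothesis is applied to it with this
      bound.\<close>
    unfolding matrix_power_Suc_apply[OF fin] power_Suc2 mult.assoc
    using oscillation_contraction[OF fin _ _ row overlap Suc.prems] by (intro Suc.IH)
qed

lemma matrix_power_stationary: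
  assumes fin: "finite S"
    and stat: "\<And>y. y \<in> S \<Longrightarrow> (\<Sum>x\<in>S. \<pi> x * P x y) = \<pi> y"
  shows "(\<Sum>x\<in>S. \<pi> x * (\<Sum>w\<in>S. matrix_power S P t x w * f w)) = (\<Sum>x\<in>S. \<pi> x * f x)"
proof (induction t arbitrary: f)
  case 0
  show ?case
    by (rule sum.cong) (simp_all only: matrix_power_0_apply[OF fin])
next
  case (Suc t)
  have "(\<Sum>x\<in>S. \<pi> x * (\<Sum>w\<in>S. P x w * f w)) = (\<Sum>w\<in>S. (\<Sum>x\<in>S. \<pi> x * P x w) * f w)"
    by (simp add: sum_distrib_right sum_distrib_left mult.assoc) (rule sum.swap)
  then show ?case
    unfolding matrix_power_Suc_apply[OF fin] Suc.IH by (simp add: stat)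
qed

text \<open>By stationarity, P^t(x, A) - \<pi>(A) is a \<pi>-average of the differences P^t(x, A) -
  P^t(u, A). Each of them is controlled by the oscillation of the indicator of \<open>A\<close>,
  which is at most 1.\<close>

lemma worst_dist_le_power:
  assumes fin: "finite S" and "S \<noteq> {}"
    and row: "\<And>x. x \<in> S \<Longrightarrow> (\<Sum>w\<in>S. P x w) = 1"
    and overlap: "\<And>x y. x \<in> S \<Longrightarrow> y \<in> S \<Longrightarrow> \<alpha> \<le> (\<Sum>w\<in>S. min (P x w) (P y w))"
    and pi_nonneg: "\<And>x. x \<in> S \<Longrightarrow> 0 \<le> \<pi> x"
    and pi_sum: "(\<Sum>x\<in>S. \<pi> x) = 1"
    and stat: "\<And>y. y \<in> S \<Longrightarrow> (\<Sum>x\<in>S. \<pi> x * P x y) = \<pi> y"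
  shows "worst_dist S P \<pi> t \<le> (1 - \<alpha>) ^ t"
proof -
  have "\<bar>sum (matrix_power S P t x) A - sum \<pi> A\<bar> \<le> (1 - \<alpha>) ^ t"
    if x: "x \<in> S" and A: "A \<subseteq> S" for x A
  proof -
    define g where "g u = (\<Sum>w\<in>S. matrix_power S P t u w * of_bool (w \<in> A))" for u
    have restrict: "(\<Sum>w\<in>S. h w * of_bool (w \<in> A)) = sum h A" for h :: "'a \<Rightarrow> real"
    proof -
      have "(\<Sum>w\<in>S. h w * of_bool (w \<in> A)) = (\<Sum>w\<in>A. h w * of_bool (w \<in> A))"
        using fin A by (intro sum.mono_neutral_right) auto
      then show ?thesis by simp
    qed
    have osc: "g u - g v \<le> (1 - \<alpha>) ^ t" if "u \<in> S" "v \<in> S" for u v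
      using matrix_power_oscillation[OF fin that row overlap,
        where f = "\<lambda>w. of_bool (w \<in> A)" and b = 1 and t = t]
      unfolding g_def by simp
    \<comment> \<open>Here \<open>g u\<close> is P^t(u, A), and stationarity makes \<pi>(A) the
      \<pi>-mean of \<open>g\<close>.\<close>
    have "sum (matrix_power S P t x) A - sum \<pi> A = g x - (\<Sum>u\<in>S. \<pi> u * g u)"
      unfolding g_def by (subst matrix_power_stationary[OF fin stat]) (simp_all only: restrict)
    also have "\<dots> = (\<Sum>u\<in>S. \<pi> u * (g x - g u))"
      by (simp add: right_diff_distrib sum_subtractf sum_distrib_right[symmetric] pi_sum)
    also have "\<bar>\<dots>\<bar> \<le> (\<Sum>u\<in>S. \<pi> u * (1 - \<alpha>) ^ t)"
    proof (rule order_trans[OF sum_abs sum_mono])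
      fix u assume u: "u \<in> S"
      then have "\<bar>g x - g u\<bar> \<le> (1 - \<alpha>) ^ t"
        using osc[OF x u] osc[OF u x] by linarith
      then show "\<bar>\<pi> u * (g x - g u)\<bar> \<le> \<pi> u * (1 - \<alpha>) ^ t"
        using pi_nonneg[OF u] by (simp add: abs_mult mult_left_mono)
    qed
    also have "\<dots> = (1 - \<alpha>) ^ t"
      by (simp add: sum_distrib_right[symmetric] pi_sum)
    finally show ?thesis .
  qed
  then have "tv_dist S (matrix_power S P t x) \<pi> \<le> (1 - \<alpha>) ^ t" if "x \<in> S" for x
    unfolding tv_dist_def using that by (intro cSUP_least) auto
  then show ?thesis
    unfolding worst_dist_def using assms(1,2) by (intro Max.boundedI) auto
qed

text \<open>Since \<open>1 - \<alpha> \<le> exp (- \<alpha>)\<close>, the time \<open>t\<close> in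
  the bound already brings the distance down to \<open>\<epsilon>\<close>, so it belongs to the set
  whose infimum is the mixing time.\<close>

lemma mixing_time_le:
  assumes "\<And>t. worst_dist S P \<pi> t \<le> (1 - \<alpha>) ^ t" and "0 < \<alpha>" and "\<alpha> \<le> 1" and "0 < \<epsilon>"
  shows "mixing_time S P \<pi> \<epsilon> \<le> enat (nat \<lceil>(1 / \<alpha>) * ln (1 / \<epsilon>)\<rceil>)"
proof -
  define t where "t = nat \<lceil>(1 / \<alpha>) * ln (1 / \<epsilon>)\<rceil>"
  have "(1 / \<alpha>) * ln (1 / \<epsilon>) \<le> real t"
    unfolding t_def by (rule real_nat_ceiling_ge)
  then have "- (\<alpha> * real t) \<le> ln \<epsilon>"
    using assms by (simp add: ln_div field_simps)
  then have le: "exp (- (\<alpha> * real t)) \<le> \<epsilon>"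
    using assms(4) by (metis exp_le_cancel_iff exp_ln)
  \<comment> \<open>The assumption \<open>\<alpha> \<le> 1\<close> makes the base nonnegative, as
    monotonicity of powers requires.\<close>
  have "(1 - \<alpha>) ^ t \<le> exp (- \<alpha>) ^ t"
    using exp_ge_add_one_self[of "- \<alpha>"] assms by (intro power_mono) auto
  also have "\<dots> = exp (- (\<alpha> * real t))"
    by (simp add: exp_of_nat_mult[symmetric] mult.commute)
  finally have "worst_dist S P \<pi> t \<le> \<epsilon>"
    using assms(1)[of t] le by linarith
  then show ?thesis
    unfolding mixing_time_def t_def by (intro INF_lower) simp
qed

section \<open>The commuting chain\<close>

context group
begin

section \<open>Conjugation action: class sizes and centralizer counts\<close>

lemma conj_fixed_iff:
  assumes "g \<in> carrier G" and "x \<in> carrier G"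
  shows "conj_action G g x = x \<longleftrightarrow> g \<otimes> x = x \<otimes> g"
  using assms inv_solve_right[of x "g \<otimes> x" g] by (auto simp: conj_action_def)

lemma conj_group_action: "group_action G (carrier G) (conj_action G)"
  unfolding conj_action_def by (rule action_by_conjugation)

text \<open>Orbit-stabilizer theorem: the stabilizer of \<open>x\<close> under conjugation is its
  centralizer.\<close>

lemma conj_class_centralizer:
  assumes "x \<in> carrier G"
  shows "card (conj_class G x) * card (centralizer G x) = order G"
proof -
  have "stabilizer G (conj_action G) x = centralizer G x"
    unfolding stabilizer_def centralizer_def using assms conj_fixed_iff by blast
  then show ?thesis
    using group_action.orbit_stabilizer_theorem[OF conj_group_action assms]
    by (simp add: conj_class_def)
qed

text \<open>Burnside's lemma: the points fixed by conjugation with \<open>x\<close> form the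
  centralizer of \<open>x\<close>.\<close>

lemma centralizer_sum:
  assumes "finite (carrier G)"
  shows "(\<Sum>x\<in>carrier G. card (centralizer G x)) = card (conj_classes G) * order G"
proof -
  have "invariants (carrier G) (conj_action G) x = centralizer G x" if "x \<in> carrier G" for x
    unfolding invariants_def centralizer_def using that conj_fixed_iff by fastforce
  then show ?thesis
    using group_action.burnside[OF conj_group_action assms assms] by (simp add: conj_classes_def)
qed

lemma centralizer_subset: "centralizer G x \<subseteq> carrier G"
  by (auto simp: centralizer_def)

lemma center_subset_centralizer: "x \<in> carrier G \<Longrightarrow> center G \<subseteq> centralizer G x"
  by (auto simp: centralizer_def center_def)

lemma one_in_center: "\<one> \<in> center G"
  by (simp add: center_def)

lemma centralizer_central: "x \<in> center G \<Longrightarrow> centralizer G x = carrier G"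
  by (auto simp: centralizer_def center_def)

lemma card_centralizer_pos:
  assumes "finite (carrier G)" and "x \<in> carrier G"
  shows "0 < card (centralizer G x)"
  using assms one_in_center center_subset_centralizer finite_subset[OF centralizer_subset]
  by (metis card_gt_0_iff empty_iff subsetD)

section \<open>Transition rows and the stationary distribution\<close>

lemma commuting_chain_eq:
  assumes "y \<in> carrier G"
  shows "commuting_chain G x y = of_bool (y \<in> centralizer G x) / real (card (centralizer G x))"
  using assms by (auto simp: commuting_chain_def centralizer_def)

lemma commuting_chain_row:
  assumes "finite (carrier G)" and "x \<in> carrier G"
  shows "(\<Sum>y\<in>carrier G. commuting_chain G x y) = 1"
  using assms card_centralizer_pos[OF assms] centralizer_subset[of x]
  by (simp add: commuting_chain_eq sum_divide_distrib[symmetric] Int_absorb1)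

lemma card_conj_classes_pos:
  assumes "finite (carrier G)"
  shows "0 < card (conj_classes G)"
proof -
  have "0 < (\<Sum>x\<in>carrier G. card (centralizer G x))"
    using assms card_centralizer_pos one_closed by (intro sum_pos) auto
  then show ?thesis
    using centralizer_sum[OF assms] by (metis gr0I mult_0)
qed

text \<open>With the class size traded for the centralizer size by orbit-stabilizer, total mass 1
  and detailed balance become visible.\<close>

lemma commuting_stationary_eq:
  assumes "finite (carrier G)" and "x \<in> carrier G"
  shows "commuting_stationary G x
    = real (card (centralizer G x)) / (real (card (conj_classes G)) * real (order G))"
proof -
  have "real (order G) = real (card (conj_class G x)) * real (card (centralizer G x))"
    using conj_class_centralizer[OF assms(2)] by (metis of_nat_mult)
  then show ?thesis
    using card_centralizer_pos[OF assms] by (simp add: commuting_stationary_def)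
qed

lemma commuting_stationary_sum:
  assumes "finite (carrier G)"
  shows "(\<Sum>x\<in>carrier G. commuting_stationary G x) = 1"
proof -
  have "(\<Sum>x\<in>carrier G. real (card (centralizer G x)))
      = real (card (conj_classes G)) * real (order G)"
    using centralizer_sum[OF assms] by (metis of_nat_mult of_nat_sum)
  then show ?thesis
    using assms card_conj_classes_pos[OF assms] order_gt_0_iff_finite
    by (simp add: commuting_stationary_eq sum_divide_distrib[symmetric])
qed

lemma commuting_stationary_stationary:
  assumes fin: "finite (carrier G)" and y: "y \<in> carrier G"
  shows "(\<Sum>x\<in>carrier G. commuting_stationary G x * commuting_chain G x y) = commuting_stationary G y"
proof -
  \<comment> \<open>Detailed balance: with k classes, both sides are 1 / (k |G|) if \<open>x\<close>
    and \<open>y\<close> commute and 0 otherwise. Summing over \<open>x\<close> then leaves the row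
    sum of \<open>y\<close>.\<close>
  have "commuting_stationary G x * commuting_chain G x y
      = commuting_stationary G y * commuting_chain G y x" if "x \<in> carrier G" for x
    using card_centralizer_pos[OF fin that] card_centralizer_pos[OF fin y] that y
    by (simp add: commuting_stationary_eq[OF fin] commuting_chain_def)
  then show ?thesis
    using commuting_chain_row[OF fin y] by (simp add: sum_distrib_left[symmetric])
qed

section \<open>Overlap of two rows\<close>

lemma commuting_chain_nonneg: "0 \<le> commuting_chain G x y"
  by (simp add: commuting_chain_def)

lemma overlap_ge:
  assumes "finite (carrier G)" and "A \<subseteq> carrier G"
    and "\<And>w. w \<in> A \<Longrightarrow> p \<le> commuting_chain G x w"
    and "\<And>w. w \<in> A \<Longrightarrow> p \<le> commuting_chain G y w"
  shows "real (card A) * p \<le> (\<Sum>w\<in>carrier G. min (commuting_chain G x w) (commuting_chain G y w))"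
proof -
  have "real (card A) * p \<le> (\<Sum>w\<in>A. min (commuting_chain G x w) (commuting_chain G y w))"
    using assms by (intro sum_bounded_below) auto
  also have "\<dots> \<le> (\<Sum>w\<in>carrier G. min (commuting_chain G x w) (commuting_chain G y w))"
    using assms by (intro sum_mono2) (auto simp: commuting_chain_nonneg)
  finally show ?thesis .
qed

lemma commuting_chain_overlap:
  assumes fin: "finite (carrier G)"
    and c: "\<And>x. x \<in> carrier G - center G \<Longrightarrow> card (centralizer G x) = c"
    and noncentral: "v \<in> carrier G - center G"
    and x: "x \<in> carrier G" and y: "y \<in> carrier G"
  shows "min (real (card (center G)) / real c) (real c / real (order G))
    \<le> (\<Sum>w\<in>carrier G. min (commuting_chain G x w) (commuting_chain G y w))"
proof -
  have c_pos: "0 < c"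
    using c[OF noncentral] card_centralizer_pos[OF fin] noncentral by force
  have card_le: "card (centralizer G u) \<le> order G" for u
    unfolding order_def using centralizer_subset fin by (intro card_mono)
  have lower: "1 / real (order G) \<le> commuting_chain G u w"
    if "u \<in> carrier G" "w \<in> centralizer G u" for u w
    using that card_le[of u] card_centralizer_pos[OF fin that(1)] centralizer_subset[of u]
    by (auto simp: commuting_chain_eq frac_le)
  have central: "real c / real (order G)
      \<le> (\<Sum>w\<in>carrier G. min (commuting_chain G u w) (commuting_chain G u' w))"
    if u: "u \<in> center G" and u': "u' \<in> carrier G" for u u'
  proof -
    \<comment> \<open>No centralizer has fewer than \<open>c\<close> elements: that of a central
      element is all of \<open>G\<close>, and \<open>v\<close> witnesses that \<open>c\<close> is at
      most |G|.\<close>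
    have "c \<le> card (centralizer G u')"
      using c[of u'] card_le[of v] c[OF noncentral] u'
      by (cases "u' \<in> center G") (auto simp: centralizer_central order_def)
    then have "real c / real (order G) \<le> real (card (centralizer G u')) * (1 / real (order G))"
      by (simp add: divide_right_mono)
    \<comment> \<open>Here \<open>overlap_ge\<close> is used with the centralizer of
      \<open>u'\<close>, on which both rows are at least 1 / |G|.\<close>
    also have "\<dots> \<le> (\<Sum>w\<in>carrier G. min (commuting_chain G u w) (commuting_chain G u' w))"
      using lower[of u] lower[of u'] centralizer_subset[of u'] u u' centralizer_central[OF u]
      by (intro overlap_ge[OF fin]) (auto simp: center_def)
    finally show ?thesis .
  qed
  consider "x \<in> center G" | "y \<in> center G" | "x \<notin> center G" "y \<notin> center G" by blast
  then show ?thesis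
  proof cases
    case 1
    then show ?thesis using central[OF 1 y] by simp
  next
    case 2
    then show ?thesis using central[OF 2 x] by (simp add: min.commute)
  next
    case 3
    have "1 / real c \<le> commuting_chain G u w" if "u \<in> carrier G - center G" "w \<in> center G" for u w
      using that c[of u] center_subset_centralizer[of u] centralizer_subset[of u]
      by (subst commuting_chain_eq) auto
    then have "real (card (center G)) * (1 / real c)
        \<le> (\<Sum>w\<in>carrier G. min (commuting_chain G x w) (commuting_chain G y w))"
      using 3 x y by (intro overlap_ge[OF fin]) (auto simp: center_def)
    then show ?thesis by simp
  qed
qed

end

theorem theorem2p4:
  fixes G :: "('a, 'b) monoid_scheme" and z c :: nat and \<alpha> \<epsilon> :: real
  assumes "CA_group G"
    and "finite (carrier G)"
    and "\<not> comm_group G"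
    and "z = card (center G)"
    and "\<And>x. x \<in> carrier G - center G \<Longrightarrow> card (centralizer G x) = c"
    and "\<alpha> = min (real z / real c) (real c / real (order G))"
    and "0 < \<epsilon>" and "\<epsilon> < 1"
  shows "commuting_mixing_time G \<epsilon> \<le> enat (nat \<lceil>(1 / \<alpha>) * ln (1 / \<epsilon>)\<rceil>)"
proof -
  interpret CA_group G by fact
  note fin = \<open>finite (carrier G)\<close>
  \<comment> \<open>Such a \<open>v\<close> makes \<open>c\<close> the size of an actual
    centralizer, hence positive and at most |G|; without it the hypothesis on \<open>c\<close> would
    be vacuous.\<close>
  obtain v where v: "v \<in> carrier G - center G"
  proof (rule ccontr)
    assume "\<not> thesis"
    then have "carrier G \<subseteq> center G" using that by blast
    then have "comm_group G"
      by (intro group_comm_groupI) (auto simp: center_def)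
    with assms(3) show False ..
  qed
  then have centralizer_v: "card (centralizer G v) = c" and "v \<in> carrier G"
    using assms(5) by auto
  have "0 < c" and "0 < order G"
    using card_centralizer_pos[OF fin \<open>v \<in> carrier G\<close>] centralizer_v fin order_gt_0_iff_finite
    by auto
  moreover have "0 < z"
    using assms(4) one_in_center fin finite_subset[of "center G" "carrier G"]
    by (auto simp: card_gt_0_iff center_def)
  moreover have "c \<le> order G"
    using centralizer_v card_mono[OF fin centralizer_subset] by (metis order_def)
  \<comment> \<open>Both quotients in the minimum are positive, and \<open>c \<le> order G\<close>
    bounds the second by 1.\<close>
  ultimately have "0 < \<alpha>" and "\<alpha> \<le> 1"
    using assms(6) by (auto simp: min_le_iff_disj)
  have "\<alpha> \<le> (\<Sum>w\<in>carrier G. min (commuting_chain G x w) (commuting_chain G y w))"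
    if "x \<in> carrier G" "y \<in> carrier G" for x y
    using commuting_chain_overlap[OF fin assms(5) v that] assms(4,6) by simp
  then have "worst_dist (carrier G) (commuting_chain G) (commuting_stationary G) t \<le> (1 - \<alpha>) ^ t" for t
    using fin commuting_chain_row[OF fin] commuting_stationary_sum[OF fin]
      commuting_stationary_stationary[OF fin] one_closed
    by (intro worst_dist_le_power) (auto simp: commuting_stationary_def)
  then show ?thesis
    unfolding commuting_mixing_time_def
    by (rule mixing_time_le) fact+
qed

end
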